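(* Let $n\ge3$, let $t$ be an indeterminate, let $f(t),w(t),y(t),v(t)\in\mathbb{Z}[t^{\pm1}]$ with $f(t)$ and $v(t)$ invertible in $\mathbb{Z}[t^{\pm1}]$, and let $\eta_2':VST_n\to\mathrm{GL}_n(\mathbb{Z}[t^{\pm1}])$ be the representation of the virtual singular twin group given, for $1\le i\le n-1$, by $$\eta_2'(s_i)=\begin{pmatrix} I_{i-1}&0&0&0\\0&0&f(t)&0\\0&\frac1{f(t)}&0&0\\0&0&0&I_{n-i-1}\end{pmatrix},\qquad \eta_2'(\tau_i)=\begin{pmatrix} I_{i-1}&0&0&0\\0&w(t)&f^2(t)y(t)&0\\0&y(t)&w(t)&0\\0&0&0&I_{n-i-1}\end{pmatrix},$$ $$\eta_2'(\nu_i)=\begin{pmatrix} I_{i-1}&0&0&0\\0&0&v(t)&0\\0&\frac{1}{v(t)}&0&0\\0&0&0&I_{n-i-1}\end{pmatrix}.$$ Then $\eta_2'$ is irreducible if and only if $f(t)\neq v(t)$ or $w(t)+\dfrac{f^2(t)y(t)}{v(t)}\neq1$ or $v(t)y(t)+w(t)\neq1$.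
   Context: The virtual singular twin group $VST_n$ is the group generated by $s_i,\tau_i,\nu_i$ ($1\le i\le n-1$) subject to: $s_i^2=1$, $\nu_i^2=1$ and $\tau_is_i=s_i\tau_i$ for all $i$; $s_is_j\tau_i=\tau_js_is_j$, $\nu_i\nu_j\nu_i=\nu_j\nu_i\nu_j$, $\nu_is_j\nu_i=\nu_js_i\nu_j$, $\nu_i\tau_j\nu_i=\nu_j\tau_i\nu_j$ for $|i-j|=1$; and $g_ih_j=h_jg_i$ for $|i-j|\ge 2$, where $g_i,h_i\in\{s_i,\tau_i,\nu_i\}$. $I_r$ is the $r\times r$ identity matrix. That $\eta_2'$ takes values in $\mathrm{GL}_n(\mathbb{Z}[t^{\pm1}])$ includes that the matrices $\eta_2'(\tau_i)$ are invertible over $\mathbb{Z}[t^{\pm1}]$. Matrices over $\mathbb{Z}[t^{\pm1}]$ act on column vectors in $\mathbb{Z}^n[t^{\pm1}]$. A representation is irreducible if it does not admit a proper nontrivial invariant subspace, i.e. it does not have a nontrivial subrepresentation; otherwise it is reducible. *)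

theory Defs
  imports
    "HOL-Algebra.Group"
    "HOL-Library.Poly_Mapping"
    "HOL-Computational_Algebra.Fraction_Field"
    "Jordan_Normal_Form.Matrix"
    "Jordan_Normal_Form.VS_Connect"
begin

section \<open>Groups given by generators and relations\<close>

text \<open>A word is a list of signed generators: \<open>(True, x)\<close> is the letter \<open>x\<close> and \<open>(False, x)\<close> is its
  formal inverse. A relation \<open>u = v\<close> is a pair of lists of generators. Two words represent the same
  element iff they are related by the least congruence that cancels formal inverses and contains
  the relations.\<close>

inductive pres_eq ::
  "'g set \<Rightarrow> ('g list \<times> 'g list) set \<Rightarrow> (bool \<times> 'g) list \<Rightarrow> (bool \<times> 'g) list \<Rightarrow> bool"
  for X :: "'g set" and R :: "('g list \<times> 'g list) set"
where
  refl: "w \<in> lists (UNIV \<times> X) \<Longrightarrow> pres_eq X R w w"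
| sym: "pres_eq X R u v \<Longrightarrow> pres_eq X R v u"
| trans: "pres_eq X R u v \<Longrightarrow> pres_eq X R v w \<Longrightarrow> pres_eq X R u w"
| append: "pres_eq X R u u' \<Longrightarrow> pres_eq X R v v' \<Longrightarrow> pres_eq X R (u @ v) (u' @ v')"
| cancel: "x \<in> X \<Longrightarrow> pres_eq X R [(b, x), (\<not> b, x)] []"
| rel: "(u, v) \<in> R \<Longrightarrow> u \<in> lists X \<Longrightarrow> v \<in> lists X \<Longrightarrow>
    pres_eq X R (map (Pair True) u) (map (Pair True) v)"

definition pres_rel ::
  "'g set \<Rightarrow> ('g list \<times> 'g list) set \<Rightarrow> ((bool \<times> 'g) list \<times> (bool \<times> 'g) list) set"
where
  "pres_rel X R = {(u, v). pres_eq X R u v}"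

definition presented_group ::
  "'g set \<Rightarrow> ('g list \<times> 'g list) set \<Rightarrow> (bool \<times> 'g) list set monoid"
where
  "presented_group X R =
    \<lparr>carrier = lists (UNIV \<times> X) // pres_rel X R,
     mult = (\<lambda>A B. \<Union>u\<in>A. \<Union>v\<in>B. pres_rel X R `` {u @ v}),
     one = pres_rel X R `` {[]}\<rparr>"

definition pres_gen ::
  "'g set \<Rightarrow> ('g list \<times> 'g list) set \<Rightarrow> 'g \<Rightarrow> (bool \<times> 'g) list set"
where
  "pres_gen X R x = pres_rel X R `` {[(True, x)]}"

lemma pres_eq_in_lists:
  assumes "pres_eq X R u v"
  shows "u \<in> lists (UNIV \<times> X) \<and> v \<in> lists (UNIV \<times> X)"
  using assms by induction auto

lemma equiv_pres_rel: "equiv (lists (UNIV \<times> X)) (pres_rel X R)"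
proof (rule equivI)
  show "pres_rel X R \<subseteq> lists (UNIV \<times> X) \<times> lists (UNIV \<times> X)"
    unfolding pres_rel_def using pres_eq_in_lists[of X R] by blast
  show "refl_on (lists (UNIV \<times> X)) (pres_rel X R)"
    by (rule refl_onI) (auto simp: pres_rel_def intro: pres_eq.refl)
  show "sym (pres_rel X R)"
    by (auto simp: pres_rel_def intro!: symI intro: pres_eq.sym)
  show "trans (pres_rel X R)"
    by (auto simp: pres_rel_def intro!: transI intro: pres_eq.trans)
qed

lemma presented_group_mult:
  assumes "u \<in> lists (UNIV \<times> X)" "v \<in> lists (UNIV \<times> X)"
  shows "(pres_rel X R `` {u}) \<otimes>\<^bsub>presented_group X R\<^esub> (pres_rel X R `` {v})
    = pres_rel X R `` {u @ v}"
proof -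
  have c: "congruent2 (pres_rel X R) (pres_rel X R) (\<lambda>a b. pres_rel X R `` {a @ b})"
    unfolding congruent2_def
    by (clarify, rule equiv_class_eq[OF equiv_pres_rel])
       (auto simp: pres_rel_def intro: pres_eq.append)
  show ?thesis
    unfolding presented_group_def
    using UN_equiv_class2[OF equiv_pres_rel equiv_pres_rel c assms] by simp
qed

lemma presented_group_inverse:
  assumes "w \<in> lists (UNIV \<times> X)"
  shows "\<exists>w' \<in> lists (UNIV \<times> X). pres_eq X R (w' @ w) []"
  using assms
proof (induction w)
  case Nil
  then show ?case by (intro bexI[of _ "[]"]) (auto intro: pres_eq.refl)
next
  case (Cons a w)
  obtain b x where a: "a = (b, x)" by (cases a)
  from Cons a have x: "x \<in> X" and w: "w \<in> lists (UNIV \<times> X)" by auto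
  from Cons obtain w' where w': "w' \<in> lists (UNIV \<times> X)" "pres_eq X R (w' @ w) []" by auto
  have "pres_eq X R [(\<not> b, x), (b, x)] []"
    using pres_eq.cancel[OF x, of R "\<not> b"] by simp
  then have "pres_eq X R (w' @ ([(\<not> b, x), (b, x)] @ w)) (w' @ ([] @ w))"
    by (intro pres_eq.append pres_eq.refl w w')
  with w'(2) have "pres_eq X R ((w' @ [(\<not> b, x)]) @ (a # w)) []"
    unfolding a by (auto intro: pres_eq.trans)
  moreover have "w' @ [(\<not> b, x)] \<in> lists (UNIV \<times> X)" using w' x by auto
  ultimately show ?case by blast
qed

lemma group_presented_group: "group (presented_group X R)"
proof (rule groupI)
  let ?G = "presented_group X R" and ?L = "lists (UNIV \<times> X)"
  have carr: "pres_rel X R `` {u} \<in> carrier ?G" if "u \<in> ?L" for u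
    using that by (auto simp: presented_group_def intro: quotientI)
  have rep: "\<exists>u \<in> ?L. A = pres_rel X R `` {u}" if "A \<in> carrier ?G" for A
    using that by (auto simp: presented_group_def elim!: quotientE)
  have one: "\<one>\<^bsub>?G\<^esub> = pres_rel X R `` {[]}" by (simp add: presented_group_def)
  have app: "u @ v \<in> ?L" if "u \<in> ?L" "v \<in> ?L" for u v using that by auto
  show "\<one>\<^bsub>?G\<^esub> \<in> carrier ?G" unfolding one by (rule carr) simp
  fix A B C assume "A \<in> carrier ?G"
  then obtain u where u: "u \<in> ?L" "A = pres_rel X R `` {u}" using rep by blast
  have nil: "[] \<in> ?L" by simp
  show "\<one>\<^bsub>?G\<^esub> \<otimes>\<^bsub>?G\<^esub> A = A"
    unfolding one u(2) presented_group_mult[OF nil u(1)] by simp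
  obtain u' where u': "u' \<in> ?L" "pres_eq X R (u' @ u) []"
    using presented_group_inverse[OF u(1)] by blast
  have "(pres_rel X R `` {u'}) \<otimes>\<^bsub>?G\<^esub> A = \<one>\<^bsub>?G\<^esub>"
    unfolding one u(2) presented_group_mult[OF u'(1) u(1)]
    by (rule equiv_class_eq[OF equiv_pres_rel]) (simp add: pres_rel_def u'(2))
  then show "\<exists>B\<in>carrier ?G. B \<otimes>\<^bsub>?G\<^esub> A = \<one>\<^bsub>?G\<^esub>" using carr[OF u'(1)] by blast
  assume "B \<in> carrier ?G"
  then obtain v where v: "v \<in> ?L" "B = pres_rel X R `` {v}" using rep by blast
  show "A \<otimes>\<^bsub>?G\<^esub> B \<in> carrier ?G"
    unfolding u(2) v(2) presented_group_mult[OF u(1) v(1)] by (intro carr app u v)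
  assume "C \<in> carrier ?G"
  then obtain w where w: "w \<in> ?L" "C = pres_rel X R `` {w}" using rep by blast
  show "A \<otimes>\<^bsub>?G\<^esub> B \<otimes>\<^bsub>?G\<^esub> C = A \<otimes>\<^bsub>?G\<^esub> (B \<otimes>\<^bsub>?G\<^esub> C)"
    unfolding u(2) v(2) w(2) presented_group_mult[OF u(1) v(1)] presented_group_mult[OF v(1) w(1)]
      presented_group_mult[OF app[OF u(1) v(1)] w(1)]
      presented_group_mult[OF u(1) app[OF v(1) w(1)]]
    by simp
qed


section \<open>The virtual singular twin group\<close>

datatype vst_letter = S nat | Tau nat | Nu nat

definition vst_letters :: "nat \<Rightarrow> vst_letter set" where
  "vst_letters n = S ` {1..n-1} \<union> Tau ` {1..n-1} \<union> Nu ` {1..n-1}"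

definition vst_relations :: "nat \<Rightarrow> (vst_letter list \<times> vst_letter list) set" where
  "vst_relations n =
     (\<Union>i\<in>{1..n-1}. {([S i, S i], []), ([Nu i, Nu i], []), ([Tau i, S i], [S i, Tau i])})
   \<union> (\<Union>(i, j) \<in> {(i, j). i \<in> {1..n-1} \<and> j \<in> {1..n-1} \<and> \<bar>int i - int j\<bar> = 1}.
       {([S i, S j, Tau i], [Tau j, S i, S j]),
        ([Nu i, Nu j, Nu i], [Nu j, Nu i, Nu j]),
        ([Nu i, S j, Nu i], [Nu j, S i, Nu j]),
        ([Nu i, Tau j, Nu i], [Nu j, Tau i, Nu j])})
   \<union> {([g i, h j], [h j, g i]) | g h i j.
        g \<in> {S, Tau, Nu} \<and> h \<in> {S, Tau, Nu} \<and>
        i \<in> {1..n-1} \<and> j \<in> {1..n-1} \<and> \<bar>int i - int j\<bar> \<ge> 2}"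

definition VST :: "nat \<Rightarrow> (bool \<times> vst_letter) list set monoid" where
  "VST n = presented_group (vst_letters n) (vst_relations n)"

definition vst_gen :: "nat \<Rightarrow> vst_letter \<Rightarrow> (bool \<times> vst_letter) list set" where
  "vst_gen n = pres_gen (vst_letters n) (vst_relations n)"


section \<open>Laurent polynomials and matrices\<close>

text \<open>The ring of Laurent polynomials is the group ring of the additive group of integers:
  finitely supported maps from exponents to coefficients, with convolution as multiplication.
  The indeterminate is \<open>Poly_Mapping.single 1 1\<close>.\<close>

type_synonym laurent = "int \<Rightarrow>\<^sub>0 int"

text \<open>The type class of \<^typ>\<open>laurent\<close> carries no inverse operation. The following is the inverse
  of an invertible element, and unspecified otherwise.\<close>

definition unit_inv :: "'a :: comm_ring_1 \<Rightarrow> 'a" where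
  "unit_inv a = (THE b. a * b = 1)"

lemma unit_inv:
  assumes "a dvd 1"
  shows "a * unit_inv a = 1"
  unfolding unit_inv_def
proof (rule theI')
  from assms obtain b where b: "a * b = 1" by (auto elim!: dvdE)
  show "\<exists>!b. a * b = 1"
  proof (rule ex1I[where a = b])
    show "a * b = 1" by (rule b)
    fix c assume "a * c = 1"
    then have "b = b * (a * c)" by simp
    also have "\<dots> = c" using b by (metis mult.assoc mult.commute mult_1_left)
    finally show "c = b" ..
  qed
qed

definition GL :: "nat \<Rightarrow> 'a :: comm_ring_1 mat monoid" where
  "GL n = units_of (ring_mat TYPE('a) n ())"

definition local_mat :: "nat \<Rightarrow> nat \<Rightarrow> 'a :: comm_ring_1 mat \<Rightarrow> 'a mat" where
  "local_mat n i B = diag_block_mat [1\<^sub>m (i - 1), B, 1\<^sub>m (n - i - 1)]"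


section \<open>Irreducible representations over an integral domain\<close>

text \<open>Over an integral domain \<open>R\<close> with field of fractions \<open>K\<close>, a subspace of \<open>R\<^sup>n\<close> is the set of
  vectors of \<open>R\<^sup>n\<close> that lie in some \<open>K\<close>-linear subspace of \<open>K\<^sup>n\<close>. Admitting all \<open>R\<close>-submodules
  instead would make every representation over a domain that is not a field reducible, because
  \<open>c R\<^sup>n\<close> is invariant for each \<open>c \<in> R\<close>.\<close>

definition subspace_of_lattice :: "nat \<Rightarrow> 'a :: idom vec set \<Rightarrow> bool" where
  "subspace_of_lattice n U \<longleftrightarrow>
     (\<exists>W. VectorSpace.subspace class_ring W (module_vec TYPE('a fract) n) \<and>
          U = {x \<in> carrier_vec n. map_vec (\<lambda>a. Fraction_Field.Fract a 1) x \<in> W})"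

definition irreducible_rep ::
  "('g, 'b) monoid_scheme \<Rightarrow> nat \<Rightarrow> ('g \<Rightarrow> 'a :: idom mat) \<Rightarrow> bool"
where
  "irreducible_rep G n \<rho> \<longleftrightarrow>
     \<not> (\<exists>U. subspace_of_lattice n U \<and> U \<noteq> {0\<^sub>v n} \<and> U \<noteq> carrier_vec n \<and>
            (\<forall>g \<in> carrier G. \<forall>x \<in> U. \<rho> g *\<^sub>v x \<in> U))"

end

theory Submission
  imports Defs
begin

text \<open>
  Put \<open>u = 1/v\<close> and write vectors in the basis \<open>u\<^sup>j e\<^sub>j\<close>. Each \<open>\<nu>\<^sub>i\<close> then swaps two adjacent
  coordinates, and every other generator still acts as one \<open>2 \<times> 2\<close> block on two adjacent
  coordinates: \<open>s\<^sub>i\<close> by \<open>(0, f/v; v/f, 0)\<close> and \<open>\<tau>\<^sub>i\<close> by \<open>(w, f\<^sup>2y/v; vy, w)\<close>. An invariant subspace is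
  therefore in particular a subspace of the permutation module of the symmetric group. A proper
  nonzero one falls under one of two cases.

  \<^item> It contains a vector with two different coordinates. Subtracting a swapped copy and cancelling a
    scalar gives a difference of two basis vectors. Applied to such differences, a block with a
    column sum other than \<open>1\<close> yields a nonzero multiple of a basis vector, hence everything. So all
    column sums are \<open>1\<close> (\<open>column_sums_if_nonconstant\<close>).
  \<^item> All its vectors have constant coordinates. The image of a nonzero constant vector has the row
    sums as two of its coordinates and the old value elsewhere, and there is such an
    elsewhere because \<open>n \<ge> 3\<close>. So all row sums are \<open>1\<close> (\<open>row_sums_if_constant\<close>).

  For the block of \<open>s\<^sub>i\<close> either alternative says \<open>f = v\<close>; for that of \<open>\<tau>\<^sub>i\<close> both say
  \<open>w + f\<^sup>2y/v = 1\<close> and \<open>vy + w = 1\<close>, since the two sums merely change places. Conversely, if these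
  equations hold, then all column sums are \<open>1\<close>, so every group element preserves the sum of the new
  coordinates, which in the old ones is \<open>\<Sum> v\<^sup>j x\<^sub>j\<close>. The kernel of this functional is a proper
  nontrivial invariant subspace. The argument works over any integral domain.
\<close>

section \<open>Words in the generators\<close>

lemma presented_group_subset_subgroup:
  assumes H: "subgroup H (presented_group X R)"
    and gens: "\<And>x. x \<in> X \<Longrightarrow> pres_gen X R x \<in> H"
  shows "carrier (presented_group X R) \<subseteq> H"
proof
  let ?G = "presented_group X R" and ?c = "\<lambda>u. pres_rel X R `` {u}"
  interpret G: group ?G by (rule group_presented_group)
  have one: "\<one>\<^bsub>?G\<^esub> = ?c []" by (simp add: presented_group_def)
  have letter: "?c [(b, x)] \<in> H" if x: "x \<in> X" for b x
  proof (cases b)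
    case True
    then show ?thesis using gens[OF x] by (simp add: pres_gen_def)
  next
    case False
    have "?c [(False, x)] \<otimes>\<^bsub>?G\<^esub> ?c [(True, x)] = ?c ([(False, x)] @ [(True, x)])"
      by (rule presented_group_mult) (use x in auto)
    also have "\<dots> = \<one>\<^bsub>?G\<^esub>"
      unfolding one using pres_eq.cancel[OF x, of R False]
      by (intro equiv_class_eq[OF equiv_pres_rel]) (simp add: pres_rel_def)
    finally have "inv\<^bsub>?G\<^esub> (?c [(True, x)]) = ?c [(False, x)]"
      using x by (intro G.inv_equality) (auto simp: presented_group_def intro!: quotientI)
    then show ?thesis
      using False subgroup.m_inv_closed[OF H gens[OF x]] by (simp add: pres_gen_def)
  qed
  have word: "?c u \<in> H" if "u \<in> lists (UNIV \<times> X)" for u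
    using that
  proof (induction u)
    case Nil
    then show ?case using subgroup.one_closed[OF H] by (simp add: one)
  next
    case (Cons l u)
    obtain b x where l: "l = (b, x)" by (cases l)
    have "?c [l] \<otimes>\<^bsub>?G\<^esub> ?c u = ?c ([l] @ u)"
      by (rule presented_group_mult) (use Cons.hyps in auto)
    moreover have "?c [l] \<in> H" using letter Cons.hyps by (auto simp: l)
    moreover have "?c u \<in> H" using Cons.IH Cons.hyps by auto
    ultimately show ?case using subgroup.m_closed[OF H, of "?c [l]" "?c u"] by simp
  qed
  fix g assume "g \<in> carrier ?G"
  then show "g \<in> H" using word by (auto simp: presented_group_def elim!: quotientE)
qed

text \<open>The elements that preserve \<open>\<phi>\<close> form a subgroup. For the elements that map a given subspace
  into itself, closure under inverses would need a dimension argument; for a functional it is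
  immediate, and then its kernel is invariant too.\<close>

lemma functional_invariant_if_generators:
  fixes \<rho> :: "(bool \<times> 'g) list set \<Rightarrow> 'a :: comm_ring_1 mat"
  assumes hom: "\<rho> \<in> hom (presented_group X R) (GL n)"
    and gens: "\<And>x z. x \<in> X \<Longrightarrow> z \<in> carrier_vec n \<Longrightarrow> \<phi> (\<rho> (pres_gen X R x) *\<^sub>v z) = \<phi> z"
    and g: "g \<in> carrier (presented_group X R)" and z: "z \<in> carrier_vec n"
  shows "\<phi> (\<rho> g *\<^sub>v z) = \<phi> z"
proof -
  let ?G = "presented_group X R"
  interpret G: group ?G by (rule group_presented_group)
  have GL: "group (GL n :: 'a mat monoid)"
    unfolding GL_def using ring_mat by (rule monoid.units_group[OF ring.is_monoid])
  interpret \<rho>: group_hom ?G "GL n" \<rho>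
    using GL hom by (simp add: group_hom_def group_hom_axioms_def G.is_group)
  have mat: "\<rho> g \<in> carrier_mat n n" if "g \<in> carrier ?G" for g
    using \<rho>.hom_closed[OF that] by (auto simp: GL_def units_of_def Units_def ring_mat_simps)
  have mult: "\<rho> (g \<otimes>\<^bsub>?G\<^esub> h) *\<^sub>v z = \<rho> g *\<^sub>v (\<rho> h *\<^sub>v z)"
    if "g \<in> carrier ?G" "h \<in> carrier ?G" "z \<in> carrier_vec n" for g h z
    using that assoc_mult_mat_vec[OF mat mat that(3), of g h]
    by (simp add: GL_def units_of_def ring_mat_simps)
  have one: "\<rho> \<one>\<^bsub>?G\<^esub> = 1\<^sub>m n"
    using \<rho>.hom_one by (simp add: GL_def units_of_def ring_mat_simps)
  let ?H = "{g \<in> carrier ?G. \<forall>z \<in> carrier_vec n. \<phi> (\<rho> g *\<^sub>v z) = \<phi> z}"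
  have "subgroup ?H ?G"
  proof (rule G.subgroupI)
    have "\<one>\<^bsub>?G\<^esub> \<in> ?H" using one by auto
    then show "?H \<noteq> {}" by blast
  next
    fix g assume g: "g \<in> ?H"
    have "\<phi> (\<rho> (inv\<^bsub>?G\<^esub> g) *\<^sub>v z) = \<phi> z" if z: "z \<in> carrier_vec n" for z
    proof -
      have "\<phi> (\<rho> (inv\<^bsub>?G\<^esub> g) *\<^sub>v z) = \<phi> (\<rho> g *\<^sub>v (\<rho> (inv\<^bsub>?G\<^esub> g) *\<^sub>v z))"
        using g z mat[of "inv\<^bsub>?G\<^esub> g"] by auto
      also have "\<dots> = \<phi> (\<rho> (g \<otimes>\<^bsub>?G\<^esub> inv\<^bsub>?G\<^esub> g) *\<^sub>v z)" using g z by (subst mult) auto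
      also have "\<dots> = \<phi> z" using g z one by auto
      finally show ?thesis .
    qed
    then show "inv\<^bsub>?G\<^esub> g \<in> ?H" using g by auto
  next
    fix g h assume gh: "g \<in> ?H" "h \<in> ?H"
    have "\<phi> (\<rho> (g \<otimes>\<^bsub>?G\<^esub> h) *\<^sub>v z) = \<phi> z" if z: "z \<in> carrier_vec n" for z
    proof -
      have "\<rho> h *\<^sub>v z \<in> carrier_vec n" using mat[of h] gh z by auto
      then show ?thesis using gh z by (subst mult) auto
    qed
    then show "g \<otimes>\<^bsub>?G\<^esub> h \<in> ?H" using gh by auto
  qed auto
  moreover have "pres_gen X R x \<in> ?H" if "x \<in> X" for x
    using gens[OF that] that by (auto simp: presented_group_def pres_gen_def intro!: quotientI)
  ultimately have "carrier ?G \<subseteq> ?H" by (rule presented_group_subset_subgroup)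
  then show ?thesis using g z by auto
qed


section \<open>Subspaces of a lattice\<close>

lemma fract_1_eq_iff: "Fraction_Field.Fract (a :: 'a :: idom) 1 = Fraction_Field.Fract b 1 \<longleftrightarrow> a = b"
  by (simp add: eq_fract)

lemma fract_1_sum:
  "(\<Sum>j\<in>J. Fraction_Field.Fract (h j :: 'a :: idom) 1) = Fraction_Field.Fract (\<Sum>j\<in>J. h j) 1"
  by (induction J rule: infinite_finite_induct) (auto simp: Zero_fract_def)

text \<open>Apart from the submodule laws, an intersection with a subspace over the field of fractions is
  saturated: scalars can be cancelled.\<close>

lemma subspace_of_lattice_closed:
  fixes U :: "'a :: idom vec set"
  assumes U: "subspace_of_lattice n U"
  shows "U \<subseteq> carrier_vec n" and "0\<^sub>v n \<in> U"
    and "x \<in> U \<Longrightarrow> z \<in> U \<Longrightarrow> x + z \<in> U"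
    and "x \<in> U \<Longrightarrow> k \<cdot>\<^sub>v x \<in> U"
    and "k \<noteq> 0 \<Longrightarrow> x \<in> carrier_vec n \<Longrightarrow> k \<cdot>\<^sub>v x \<in> U \<Longrightarrow> x \<in> U"
proof -
  let ?F = "\<lambda>x :: 'a vec. map_vec (\<lambda>a. Fraction_Field.Fract a 1) x"
  let ?V = "module_vec TYPE('a fract) n"
  obtain W where W: "VectorSpace.subspace class_ring W ?V"
    and U: "U = {x \<in> carrier_vec n. ?F x \<in> W}"
    using U by (auto simp: subspace_of_lattice_def)
  interpret W: submodule class_ring W ?V
    using W by (simp add: VectorSpace.subspace_def)
  have add: "z + z' \<in> W" if "z \<in> W" "z' \<in> W" for z z'
    using W.m_closed[OF that] by (simp add: module_vec_simps)
  have smult: "k \<cdot>\<^sub>v z \<in> W" if "z \<in> W" for k z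
    using W.smult_closed[OF _ that, of k] by (simp add: module_vec_simps)
  have F_add: "?F (x + z) = ?F x + ?F z" if "x \<in> carrier_vec n" "z \<in> carrier_vec n" for x z
    using that by (intro eq_vecI) auto
  have F_smult: "?F (k \<cdot>\<^sub>v x) = Fraction_Field.Fract k 1 \<cdot>\<^sub>v ?F x" for k x
    by (intro eq_vecI) auto
  have F_0: "?F (0\<^sub>v n) = 0\<^sub>v n" by (intro eq_vecI) (auto simp: Zero_fract_def)
  show "U \<subseteq> carrier_vec n" unfolding U by auto
  show "0\<^sub>v n \<in> U" using W.zero_closed by (simp add: U F_0 module_vec_simps)
  show "x + z \<in> U" if "x \<in> U" "z \<in> U" using that add by (simp add: U F_add)
  show "k \<cdot>\<^sub>v x \<in> U" if "x \<in> U" using that smult by (simp add: U F_smult)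
  show "x \<in> U" if k: "k \<noteq> 0" and x: "x \<in> carrier_vec n" "k \<cdot>\<^sub>v x \<in> U"
  proof -
    have "Fraction_Field.Fract 1 k \<cdot>\<^sub>v (Fraction_Field.Fract k 1 \<cdot>\<^sub>v ?F x) \<in> W"
      using x smult by (simp add: U F_smult)
    also have "Fraction_Field.Fract 1 k \<cdot>\<^sub>v (Fraction_Field.Fract k 1 \<cdot>\<^sub>v ?F x) = ?F x"
      using k by (intro eq_vecI) (auto simp: eq_fract)
    finally show ?thesis using x by (simp add: U)
  qed
qed

text \<open>A linear functional over the domain extends to the field of fractions.\<close>

lemma subspace_of_lattice_kernel:
  fixes k :: "nat \<Rightarrow> 'a :: idom"
  shows "subspace_of_lattice n {x \<in> carrier_vec n. (\<Sum>j<n. k j * x $ j) = 0}"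
proof -
  let ?K = "\<lambda>j. Fraction_Field.Fract (k j) 1"
  let ?W = "{z \<in> carrier_vec n. (\<Sum>j<n. ?K j * z $ j) = 0}"
  have "VectorSpace.subspace class_ring ?W (module_vec TYPE('a fract) n)"
  proof (rule VectorSpace.subspace.intro[OF vec_vs], rule submodule.intro[OF vec_module],
      goal_cases)
    case (4 c z)
    then have z: "z \<in> carrier_vec n" "(\<Sum>j<n. ?K j * z $ j) = 0"
      by (auto simp: module_vec_simps)
    have "(\<Sum>j<n. ?K j * (c \<cdot>\<^sub>v z) $ j) = c * (\<Sum>j<n. ?K j * z $ j)"
      using z(1) by (auto simp: sum_distrib_left mult_ac intro!: sum.cong)
    also have "\<dots> = 0" unfolding z(2) by simp
    finally have "c \<cdot>\<^sub>v z \<in> ?W" using z(1) by simp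
    then show ?case by (simp only: module_vec_simps)
  qed (auto simp: module_vec_simps ring_distribs sum.distrib)
  moreover have "(\<Sum>j<n. ?K j * map_vec (\<lambda>a. Fraction_Field.Fract a 1) x $ j) = 0
      \<longleftrightarrow> (\<Sum>j<n. k j * x $ j) = 0" if x: "x \<in> carrier_vec n" for x
  proof -
    have "(\<Sum>j<n. ?K j * map_vec (\<lambda>a. Fraction_Field.Fract a 1) x $ j)
        = Fraction_Field.Fract (\<Sum>j<n. k j * x $ j) 1"
      using x by (auto simp flip: fract_1_sum intro!: sum.cong)
    then show ?thesis by (simp add: Zero_fract_def fract_1_eq_iff)
  qed
  ultimately show ?thesis
    unfolding subspace_of_lattice_def by (intro exI[of _ ?W]) auto
qed


section \<open>Local operators in permutation coordinates\<close>

text \<open>Functions stand for coordinate tuples of unspecified length. Coordinates are counted from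
  \<open>0\<close>, so position \<open>p\<close> belongs to the generators with index \<open>p + 1\<close>.\<close>

definition local_op :: "'a \<Rightarrow> 'a \<Rightarrow> 'a \<Rightarrow> 'a \<Rightarrow> nat \<Rightarrow> (nat \<Rightarrow> 'a) \<Rightarrow> nat \<Rightarrow> 'a :: comm_ring_1" where
  "local_op a b c d p x = x(p := a * x p + b * x (Suc p), Suc p := c * x p + d * x (Suc p))"

text \<open>The vector with coordinates \<open>x\<close> in the basis \<open>u\<^sup>j e\<^sub>j\<close>.\<close>

definition gauge_vec :: "nat \<Rightarrow> 'a \<Rightarrow> (nat \<Rightarrow> 'a) \<Rightarrow> 'a :: comm_ring_1 vec" where
  "gauge_vec n u x = vec n (\<lambda>j. u ^ j * x j)"

lemma sum_split_adjacent:
  fixes h :: "nat \<Rightarrow> 'a :: comm_ring_1"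
  assumes "Suc p < n"
  shows "(\<Sum>j<n. h j) = h p + h (Suc p) + (\<Sum>j\<in>{..<n} - {p, Suc p}. h j)"
  using sum.subset_diff[of "{p, Suc p}" "{..<n}" h] assms by (simp add: add_ac)

lemma sum_local_op:
  assumes "Suc p < n" "a + c = 1" "b + d = 1"
  shows "(\<Sum>j<n. local_op a b c d p x j) = (\<Sum>j<n. x j)"
proof -
  have "a * x p + b * x (Suc p) + (c * x p + d * x (Suc p))
      = (a + c) * x p + (b + d) * x (Suc p)"
    by (simp add: algebra_simps)
  then show ?thesis
    using assms by (simp add: sum_split_adjacent[OF assms(1)] local_op_def)
qed

lemma local_mat_index:
  assumes p: "Suc p < n" and B: "B \<in> carrier_mat 2 2" and ij: "i < n" "j < n"
  shows "local_mat n (Suc p) B $$ (i, j) =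
    (if p \<le> i \<and> i < Suc (Suc p)
     then if p \<le> j \<and> j < Suc (Suc p) then B $$ (i - p, j - p) else 0
     else if i = j then 1 else 0)"
proof -
  obtain m where n: "n = Suc (Suc (p + m))"
    using p less_imp_Suc_add[of "Suc p" n] by auto
  show ?thesis
    using ij B unfolding n local_mat_def diag_block_mat.simps(2)[of "1\<^sub>m (Suc p - 1)"]
      diag_block_mat.simps(2)[of B] diag_block_mat_singleton
    by (auto simp: Let_def)
qed

lemma local_mat_mult_vec:
  assumes p: "Suc p < n" and x: "x \<in> carrier_vec n"
  shows "local_mat n (Suc p) (mat_of_rows_list 2 [[a, b], [c, d]]) *\<^sub>v x
    = vec n (local_op a b c d p (($) x))"
proof (rule eq_vecI)
  let ?L = "local_mat n (Suc p) (mat_of_rows_list 2 [[a, b], [c, d]])"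
  have L: "?L \<in> carrier_mat n n"
    using p by (auto simp: local_mat_def Let_def mat_of_rows_list_def intro!: carrier_matI)
  then show "dim_vec (?L *\<^sub>v x) = dim_vec (vec n (local_op a b c d p (($) x)))" by simp
  have entry: "?L $$ (i, j) =
      (if i = p then if j = p then a else if j = Suc p then b else 0
       else if i = Suc p then if j = p then c else if j = Suc p then d else 0
       else if i = j then 1 else 0)" if "i < n" "j < n" for i j
  proof -
    have block: "mat_of_rows_list 2 [[a, b], [c, d]] \<in> carrier_mat 2 2"
      by (simp add: mat_of_rows_list_def carrier_matI)
    consider "j < p" | "j = p" | "j = Suc p" | "Suc p < j" by linarith
    then show ?thesis
      unfolding local_mat_index[OF p block that]
      by cases (auto simp: mat_of_rows_list_def less_Suc_eq)
  qed
  fix i assume "i < dim_vec (vec n (local_op a b c d p (($) x)))"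
  then have i: "i < n" by simp
  have "(?L *\<^sub>v x) $ i = (\<Sum>j<n. ?L $$ (i, j) * x $ j)"
    using i x L by (simp add: scalar_prod_def atLeast0LessThan)
  also have "\<dots> = local_op a b c d p (($) x) i"
  proof (cases "i \<in> {p, Suc p}")
    case True
    then show ?thesis
      using i p by (auto simp: sum_split_adjacent[OF p] entry local_op_def)
  next
    case False
    then have "(\<Sum>j<n. ?L $$ (i, j) * x $ j) = (\<Sum>j<n. if i = j then x $ j else 0)"
      using i by (intro sum.cong) (auto simp: entry)
    with False i show ?thesis by (simp add: local_op_def)
  qed
  finally show "(?L *\<^sub>v x) $ i = vec n (local_op a b c d p (($) x)) $ i" using i by simp
qed

text \<open>The rescaling by powers of \<open>u\<close> multiplies the two off-diagonal entries of a block by \<open>u\<close> and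
  \<open>v = 1/u\<close>. For \<open>(0, v; u, 0)\<close> this leaves a plain swap.\<close>

lemma local_mat_mult_gauge_vec:
  assumes p: "Suc p < n" and vu: "v * u = 1"
  shows "local_mat n (Suc p) (mat_of_rows_list 2 [[a, b], [c, d]]) *\<^sub>v gauge_vec n u x
    = gauge_vec n u (local_op a (b * u) (c * v) d p x)"
proof -
  have cancel: "u * (v * k) = k" for k
    using vu by (metis mult.assoc mult.commute mult_1)
  show ?thesis
    using p by (subst local_mat_mult_vec)
      (auto simp: gauge_vec_def local_op_def algebra_simps cancel intro!: eq_vecI)
qed

lemma gauge_vec_surj:
  assumes "v * u = 1" "z \<in> carrier_vec n"
  shows "gauge_vec n u (\<lambda>j. v ^ j * z $ j) = z"
proof -
  have "u ^ j * v ^ j = 1" for j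
    using assms(1) by (metis mult.commute power_mult_distrib power_one)
  then show ?thesis
    using assms(2) by (auto simp: gauge_vec_def mult.assoc[symmetric] intro!: eq_vecI)
qed


section \<open>Saturated submodules invariant under permutations\<close>

text \<open>By \<open>cong\<close>, only the first \<open>n\<close> coordinates decide membership, so identities between tuples
  need to be checked only there. The assumption \<open>cancel\<close> replaces division by nonzero scalars.\<close>

locale saturated_permutation_module =
  fixes n :: nat and M :: "(nat \<Rightarrow> 'a :: idom) set"
  assumes add: "x \<in> M \<Longrightarrow> z \<in> M \<Longrightarrow> (\<lambda>j. x j + z j) \<in> M"
    and scale: "x \<in> M \<Longrightarrow> (\<lambda>j. k * x j) \<in> M"
    and cancel: "k \<noteq> 0 \<Longrightarrow> (\<lambda>j. k * x j) \<in> M \<Longrightarrow> x \<in> M"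
    and cong: "x \<in> M \<Longrightarrow> (\<And>j. j < n \<Longrightarrow> x j = z j) \<Longrightarrow> z \<in> M"
    and zero: "(\<lambda>j. 0) \<in> M"
    and swap: "x \<in> M \<Longrightarrow> Suc p < n \<Longrightarrow> local_op 0 1 1 0 p x \<in> M"
begin

abbreviation pt :: "nat \<Rightarrow> nat \<Rightarrow> 'a" where
  "pt q \<equiv> (\<lambda>j. if j = q then 1 else 0)"

abbreviation diff :: "nat \<Rightarrow> nat \<Rightarrow> nat \<Rightarrow> 'a" where
  "diff q r \<equiv> (\<lambda>j. pt q j - pt r j)"

lemma lincomb:
  assumes "x \<in> M" "z \<in> M"
  shows "(\<lambda>j. k * x j + l * z j) \<in> M"
  using add[OF scale[OF assms(1)] scale[OF assms(2)]] .

text \<open>One coordinate vector generates the others by swaps, and hence everything.\<close>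

lemma mem_if_pt:
  assumes q: "q < n" "pt q \<in> M"
  shows "x \<in> M"
proof -
  have up: "pt (Suc p) \<in> M \<longleftrightarrow> pt p \<in> M" if "Suc p < n" for p
  proof -
    have "local_op 0 1 1 0 p (pt p) = pt (Suc p)" "local_op 0 1 1 0 p (pt (Suc p)) = pt p"
      by (auto simp: local_op_def)
    then show ?thesis
      using swap[OF _ that, of "pt p"] swap[OF _ that, of "pt (Suc p)"] by auto
  qed
  have "pt 0 \<in> M"
    using q by (induction q) (use up in auto)
  then have pt: "pt p \<in> M" if "p < n" for p
    using that by (induction p) (use up in auto)
  have "(\<lambda>j. if j < m then x j else 0) \<in> M" if "m \<le> n" for m
    using that
  proof (induction m)
    case 0
    then show ?case using zero by simp
  next
    case (Suc m)
    then have "(\<lambda>j. 1 * (if j < m then x j else 0) + x m * pt m j) \<in> M"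
      by (intro lincomb pt) auto
    then show ?case by (rule cong) (auto simp: less_Suc_eq)
  qed
  from this[OF order_refl] show ?thesis by (rule cong) auto
qed

text \<open>Subtracting its image under a swap leaves a multiple of a difference of two coordinate
  vectors, and the multiplier can be cancelled. A third index is available on one side of the pair,
  and swapping moves the difference there.\<close>

lemma diff_mem_if_nonconstant:
  assumes n: "n \<ge> 3" and x: "x \<in> M" and p: "Suc p < n" "x p \<noteq> x (Suc p)"
  shows "\<exists>q. Suc (Suc q) < n \<and> diff q (Suc (Suc q)) \<in> M \<and> diff (Suc q) (Suc (Suc q)) \<in> M"
proof -
  have "(\<lambda>j. 1 * x j + - 1 * local_op 0 1 1 0 p x j) \<in> M"
    by (intro lincomb swap x p)
  then have "(\<lambda>j. (x p - x (Suc p)) * diff p (Suc p) j) \<in> M"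
    by (rule cong) (auto simp: local_op_def)
  then have D: "diff p (Suc p) \<in> M"
    by (rule cancel[rotated]) (use p in auto)
  show ?thesis
  proof (cases p)
    case 0
    with n have q: "Suc (Suc p) < n" by simp
    have "local_op 0 1 1 0 (Suc p) (diff p (Suc p)) \<in> M" using q by (intro swap D)
    then have E: "diff p (Suc (Suc p)) \<in> M" by (rule cong) (auto simp: local_op_def)
    have "local_op 0 1 1 0 p (diff p (Suc (Suc p))) \<in> M" using p by (intro swap E)
    then have "diff (Suc p) (Suc (Suc p)) \<in> M" by (rule cong) (auto simp: local_op_def)
    with E q show ?thesis by blast
  next
    case (Suc r)
    have "local_op 0 1 1 0 r (diff p (Suc p)) \<in> M" using p Suc by (intro swap D) auto
    then have "diff r (Suc p) \<in> M" by (rule cong) (auto simp: local_op_def Suc)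
    with D p Suc show ?thesis by blast
  qed
qed

text \<open>A local operator acts on the first two of three adjacent coordinates. Reducing its value on
  \<open>diff q (q + 2)\<close> modulo the two differences leaves \<open>a + c - 1\<close> times a coordinate vector, so a
  proper submodule requires \<open>a + c = 1\<close>; likewise \<open>diff (q + 1) (q + 2)\<close> yields the second column.\<close>

lemma column_sums_if_nonconstant:
  assumes n: "n \<ge> 3" and x: "x \<in> M" and p: "Suc p < n" "x p \<noteq> x (Suc p)"
    and proper: "z \<notin> M"
    and inv: "\<And>p x. Suc p < n \<Longrightarrow> x \<in> M \<Longrightarrow> local_op a b c d p x \<in> M"
  shows "a + c = 1 \<and> b + d = 1"
proof -
  obtain q where q: "Suc (Suc q) < n" and D: "diff q (Suc (Suc q)) \<in> M"
    and E: "diff (Suc q) (Suc (Suc q)) \<in> M"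
    using diff_mem_if_nonconstant[OF n x p] by blast
  have *: "k = 1" if k: "(\<lambda>j. (k - 1) * pt (Suc (Suc q)) j) \<in> M" for k
  proof (rule ccontr)
    assume "k \<noteq> 1"
    then have "pt (Suc (Suc q)) \<in> M" using k cancel[of "k - 1"] by auto
    then show False using mem_if_pt[OF q] proper by blast
  qed
  have reduce: "(\<lambda>j. 1 * h j + - 1 * (k * diff q (Suc (Suc q)) j + l * diff (Suc q) (Suc (Suc q)) j)) \<in> M"
    if "h \<in> M" for h k l
    by (intro lincomb that D E)
  have "a + c = 1"
  proof (rule *)
    have "local_op a b c d q (diff q (Suc (Suc q))) \<in> M" using q by (intro inv D) auto
    from reduce[OF this, of a c] show "(\<lambda>j. (a + c - 1) * pt (Suc (Suc q)) j) \<in> M"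
      by (rule cong) (auto simp: local_op_def)
  qed
  moreover have "b + d = 1"
  proof (rule *)
    have "local_op a b c d q (diff (Suc q) (Suc (Suc q))) \<in> M" using q by (intro inv E) auto
    from reduce[OF this, of b d] show "(\<lambda>j. (b + d - 1) * pt (Suc (Suc q)) j) \<in> M"
      by (rule cong) (auto simp: local_op_def)
  qed
  ultimately show ?thesis ..
qed

text \<open>The image of a constant tuple is again constant, and its third coordinate is unchanged.\<close>

lemma row_sums_if_constant:
  assumes n: "n \<ge> 3" and const: "\<And>x p. x \<in> M \<Longrightarrow> Suc p < n \<Longrightarrow> x p = x (Suc p)"
    and x: "x \<in> M" "i < n" "x i \<noteq> 0"
    and inv: "\<And>p x. Suc p < n \<Longrightarrow> x \<in> M \<Longrightarrow> local_op a b c d p x \<in> M"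
  shows "a + b = 1 \<and> c + d = 1"
proof -
  have const_0: "z j = z 0" if "z \<in> M" "j < n" for z j
    using that(2) by (induction j) (use const[OF that(1)] in auto)
  let ?z = "local_op a b c d 0 x"
  have z: "?z \<in> M" using n x by (intro inv) auto
  have "?z 0 = ?z 2" "?z 1 = ?z 2"
    using const_0[OF z, of 2] const_0[OF z, of 1] n by auto
  moreover have "x 1 = x 0" "x 2 = x 0"
    using const_0[OF x(1), of 1] const_0[OF x(1), of 2] n by auto
  ultimately have "(a + b) * x 0 = 1 * x 0" "(c + d) * x 0 = 1 * x 0"
    by (auto simp: local_op_def ring_distribs)
  moreover have "x 0 \<noteq> 0" using const_0[OF x(1,2)] x(3) by auto
  ultimately show ?thesis by (auto simp only: mult_cancel_right)
qed

end


section \<open>The reducibility criterion\<close>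

lemma saturated_permutation_module_gauge:
  fixes U :: "'a :: idom vec set"
  assumes U: "subspace_of_lattice n U" and vu: "v * u = 1"
    and nu: "\<And>p x. Suc p < n \<Longrightarrow> x \<in> U \<Longrightarrow>
      local_mat n (Suc p) (mat_of_rows_list 2 [[0, v], [u, 0]]) *\<^sub>v x \<in> U"
  shows "saturated_permutation_module n {x. gauge_vec n u x \<in> U}"
proof
  note closed = subspace_of_lattice_closed[OF U]
  have g_add: "gauge_vec n u (\<lambda>j. x j + z j) = gauge_vec n u x + gauge_vec n u z" for x z
    by (auto simp: gauge_vec_def ring_distribs intro!: eq_vecI)
  have g_scale: "gauge_vec n u (\<lambda>j. k * x j) = k \<cdot>\<^sub>v gauge_vec n u x" for k x
    by (auto simp: gauge_vec_def intro!: eq_vecI)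
  fix x z :: "nat \<Rightarrow> 'a" and k :: 'a and p
  show "(\<lambda>j. k * x j) \<in> {x. gauge_vec n u x \<in> U}" if "x \<in> {x. gauge_vec n u x \<in> U}"
    using that closed(4) by (simp add: g_scale)
  show "(\<lambda>j. x j + z j) \<in> {x. gauge_vec n u x \<in> U}"
    if "x \<in> {x. gauge_vec n u x \<in> U}" "z \<in> {x. gauge_vec n u x \<in> U}"
    using that closed(3) by (simp add: g_add)
  show "x \<in> {x. gauge_vec n u x \<in> U}" if "k \<noteq> 0" "(\<lambda>j. k * x j) \<in> {x. gauge_vec n u x \<in> U}"
    using that closed(5)[of k "gauge_vec n u x"] by (simp add: g_scale) (simp add: gauge_vec_def)
  show "z \<in> {x. gauge_vec n u x \<in> U}"
    if "x \<in> {x. gauge_vec n u x \<in> U}" "\<And>j. j < n \<Longrightarrow> x j = z j"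
  proof -
    have "gauge_vec n u z = gauge_vec n u x"
      using that(2) by (auto simp: gauge_vec_def intro!: eq_vecI)
    then show ?thesis using that(1) by simp
  qed
  have "gauge_vec n u (\<lambda>j. 0) = 0\<^sub>v n" by (auto simp: gauge_vec_def intro!: eq_vecI)
  then show "(\<lambda>j. 0) \<in> {x. gauge_vec n u x \<in> U}" using closed(2) by simp
  show "local_op 0 1 1 0 p x \<in> {x. gauge_vec n u x \<in> U}"
    if "x \<in> {x. gauge_vec n u x \<in> U}" "Suc p < n"
    using nu[OF that(2), of "gauge_vec n u x"] that
    by (simp add: local_mat_mult_gauge_vec[OF that(2) vu] vu mult.commute[of u v])
qed

text \<open>In the rescaled basis the block is \<open>(a, bu; cv, d)\<close>. The first alternative concerns its columns
  and arises when \<open>U\<close> contains a vector with nonconstant coordinates, the second one its rows.\<close>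

lemma column_or_row_sums_if_invariant:
  fixes U :: "'a :: idom vec set"
  assumes n: "n \<ge> 3" and U: "subspace_of_lattice n U" "U \<noteq> {0\<^sub>v n}" "U \<noteq> carrier_vec n"
    and vu: "v * u = 1"
    and nu: "\<And>p x. Suc p < n \<Longrightarrow> x \<in> U \<Longrightarrow>
      local_mat n (Suc p) (mat_of_rows_list 2 [[0, v], [u, 0]]) *\<^sub>v x \<in> U"
    and inv: "\<And>p x. Suc p < n \<Longrightarrow> x \<in> U \<Longrightarrow>
      local_mat n (Suc p) (mat_of_rows_list 2 [[a, b], [c, d]]) *\<^sub>v x \<in> U"
  shows "a + c * v = 1 \<and> b * u + d = 1 \<or> a + b * u = 1 \<and> c * v + d = 1"
proof -
  define M where "M = {x. gauge_vec n u x \<in> U}"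
  interpret saturated_permutation_module n M
    unfolding M_def by (rule saturated_permutation_module_gauge[OF U(1) vu nu])
  note closed = subspace_of_lattice_closed[OF U(1)]
  have inv_M: "local_op a (b * u) (c * v) d p x \<in> M" if "Suc p < n" "x \<in> M" for p x
    using inv[OF that(1), of "gauge_vec n u x"] that
    by (simp add: M_def local_mat_mult_gauge_vec[OF that(1) vu])
  show ?thesis
  proof (cases "\<exists>x p. x \<in> M \<and> Suc p < n \<and> x p \<noteq> x (Suc p)")
    case True
    obtain z where z: "z \<in> carrier_vec n" "z \<notin> U" using closed(1) U(3) by blast
    then have "(\<lambda>j. v ^ j * z $ j) \<notin> M" by (simp add: M_def gauge_vec_surj[OF vu])
    with True show ?thesis using column_sums_if_nonconstant[OF n _ _ _ _ inv_M] by blast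
  next
    case False
    obtain z where z: "z \<in> U" "z \<noteq> 0\<^sub>v n" using closed(2) U(2) by blast
    then have z': "gauge_vec n u (\<lambda>j. v ^ j * z $ j) = z"
      using closed(1) by (intro gauge_vec_surj[OF vu]) auto
    have "\<exists>i<n. v ^ i * z $ i \<noteq> 0"
    proof (rule ccontr)
      assume "\<not> ?thesis"
      then have "gauge_vec n u (\<lambda>j. v ^ j * z $ j) = 0\<^sub>v n"
        by (auto simp: gauge_vec_def intro!: eq_vecI)
      then show False using z' z by simp
    qed
    then obtain i where "i < n" "v ^ i * z $ i \<noteq> 0" by blast
    moreover have "(\<lambda>j. v ^ j * z $ j) \<in> M" using z z' by (simp add: M_def)
    ultimately show ?thesis
      using False row_sums_if_constant[OF n _ _ _ _ inv_M, of "\<lambda>j. v ^ j * z $ j" i] by blast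
  qed
qed

text \<open>This functional is the sum of the coordinates in the rescaled basis.\<close>

lemma gauge_functional_invariant:
  assumes p: "Suc p < n" and vu: "v * u = 1" and z: "z \<in> carrier_vec n"
    and sums: "a + c * v = 1" "b * u + d = 1"
  shows "(\<Sum>j<n. v ^ j * (local_mat n (Suc p) (mat_of_rows_list 2 [[a, b], [c, d]]) *\<^sub>v z) $ j)
    = (\<Sum>j<n. v ^ j * z $ j)"
proof -
  have vu_pow: "v ^ j * (u ^ j * k) = k" for j k
    using vu by (metis mult.assoc mult_1 power_mult_distrib power_one)
  have "(\<Sum>j<n. v ^ j * gauge_vec n u x $ j) = (\<Sum>j<n. x j)" for x
    by (auto simp: gauge_vec_def vu_pow)
  note gauge = this
  let ?x = "\<lambda>j. v ^ j * z $ j"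
  have "(\<Sum>j<n. v ^ j *
      (local_mat n (Suc p) (mat_of_rows_list 2 [[a, b], [c, d]]) *\<^sub>v gauge_vec n u ?x) $ j)
    = (\<Sum>j<n. ?x j)"
    by (simp only: local_mat_mult_gauge_vec[OF p vu] gauge sum_local_op[OF p sums])
  then show ?thesis by (simp only: gauge_vec_surj[OF vu z])
qed

theorem theorem18:
  fixes n :: nat
    and f w y v :: laurent
    and \<eta> :: "(bool \<times> vst_letter) list set \<Rightarrow> laurent mat"
  assumes "n \<ge> 3"
    and "f dvd 1" and "v dvd 1"
    and "\<eta> \<in> hom (VST n) (GL n)"
    and "\<And>i. 1 \<le> i \<Longrightarrow> i \<le> n - 1 \<Longrightarrow>
      \<eta> (vst_gen n (S i)) =
        local_mat n i (mat_of_rows_list 2 [[0, f], [unit_inv f, 0]])"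
    and "\<And>i. 1 \<le> i \<Longrightarrow> i \<le> n - 1 \<Longrightarrow>
      \<eta> (vst_gen n (Tau i)) =
        local_mat n i (mat_of_rows_list 2 [[w, f\<^sup>2 * y], [y, w]])"
    and "\<And>i. 1 \<le> i \<Longrightarrow> i \<le> n - 1 \<Longrightarrow>
      \<eta> (vst_gen n (Nu i)) =
        local_mat n i (mat_of_rows_list 2 [[0, v], [unit_inv v, 0]])"
  shows "irreducible_rep (VST n) n \<eta> \<longleftrightarrow>
    f \<noteq> v \<or> w + f\<^sup>2 * y * unit_inv v \<noteq> 1 \<or> v * y + w \<noteq> 1"
proof -
  note n = assms(1)
  let ?u = "unit_inv v"
  have vu: "v * ?u = 1" by (rule unit_inv[OF assms(3)])
  then have uv: "?u * v = 1" by (simp only: mult.commute)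
  have S: "\<eta> (vst_gen n (S (Suc p))) = local_mat n (Suc p) (mat_of_rows_list 2 [[0, f], [unit_inv f, 0]])"
    and Tau: "\<eta> (vst_gen n (Tau (Suc p))) = local_mat n (Suc p) (mat_of_rows_list 2 [[w, f\<^sup>2 * y], [y, w]])"
    and Nu: "\<eta> (vst_gen n (Nu (Suc p))) = local_mat n (Suc p) (mat_of_rows_list 2 [[0, v], [?u, 0]])"
    if "Suc p < n" for p
    using that assms(5,6,7)[of "Suc p"] by auto
  have letters: "vst_letters n = (\<Union>p\<in>{p. Suc p < n}. {S (Suc p), Tau (Suc p), Nu (Suc p)})"
  proof -
    have "{1..n-1} = Suc ` {p. Suc p < n}"
      using n by (auto simp: image_iff Suc_le_eq gr0_conv_Suc)
    then show ?thesis unfolding vst_letters_def by auto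
  qed
  have gen_carrier: "vst_gen n l \<in> carrier (VST n)" if "l \<in> vst_letters n" for l
    using that by (auto simp: VST_def vst_gen_def presented_group_def pres_gen_def intro!: quotientI)
  show ?thesis
  proof
    assume irr: "irreducible_rep (VST n) n \<eta>"
    show "f \<noteq> v \<or> w + f\<^sup>2 * y * ?u \<noteq> 1 \<or> v * y + w \<noteq> 1"
    proof (rule ccontr)
      assume "\<not> ?thesis"
      then have fv: "f = v" and sums: "w + f\<^sup>2 * y * ?u = 1" "v * y + w = 1" by auto
      let ?\<phi> = "\<lambda>z :: laurent vec. \<Sum>j<n. v ^ j * z $ j"
      let ?U = "{z \<in> carrier_vec n. ?\<phi> z = 0}"
      have gens: "?\<phi> (\<eta> (vst_gen n l) *\<^sub>v z) = ?\<phi> z"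
        if l_mem: "l \<in> vst_letters n" and z: "z \<in> carrier_vec n" for l z
      proof -
        obtain p where p: "Suc p < n" and l: "l \<in> {S (Suc p), Tau (Suc p), Nu (Suc p)}"
          using l_mem unfolding letters by auto
        note inv = gauge_functional_invariant[OF p vu z]
        from l show ?thesis
        proof (elim insertE emptyE)
          assume l: "l = S (Suc p)"
          show ?thesis unfolding l S[OF p] by (rule inv) (simp_all add: fv vu uv)
        next
          assume l: "l = Tau (Suc p)"
          show ?thesis
            unfolding l Tau[OF p] by (rule inv) (use sums in \<open>simp_all add: ac_simps\<close>)
        next
          assume l: "l = Nu (Suc p)"
          show ?thesis unfolding l Nu[OF p] by (rule inv) (simp_all add: vu uv)
        qed
      qed
      have \<phi>: "?\<phi> (\<eta> g *\<^sub>v z) = ?\<phi> z" if "g \<in> carrier (VST n)" "z \<in> carrier_vec n" for g z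
        by (rule functional_invariant_if_generators[OF assms(4)[unfolded VST_def]
            gens[unfolded vst_gen_def] that(1)[unfolded VST_def] that(2)])
      have mat: "\<eta> g \<in> carrier_mat n n" if "g \<in> carrier (VST n)" for g
        using assms(4) that
        by (auto simp: hom_def Pi_iff GL_def units_of_def Units_def ring_mat_simps)
      have unit: "?\<phi> (unit_vec n 0) = 1"
        using n by (simp add: sum_split_adjacent[of 0])
      have "?U \<noteq> carrier_vec n"
      proof
        assume "?U = carrier_vec n"
        then have "unit_vec n 0 \<in> ?U" by (simp only: unit_vec_carrier)
        then have "?\<phi> (unit_vec n 0) = 0" unfolding mem_Collect_eq by (rule conjunct2)
        then show False unfolding unit by (rule one_neq_zero[THEN notE])
      qed
      moreover have "?U \<noteq> {0\<^sub>v n}"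
      proof
        (* the first two coordinates v and -1 contribute v and -v to the sum *)
        let ?z = "vec n (\<lambda>j. if j = 0 then v else if j = 1 then - 1 else 0)"
        assume "?U = {0\<^sub>v n}"
        moreover have "?z \<in> ?U"
        proof -
          have "(\<Sum>j\<in>{..<n} - {0, Suc 0}. v ^ j * ?z $ j) = 0" by (rule sum.neutral) auto
          then show ?thesis using n by (simp add: sum_split_adjacent[of 0])
        qed
        ultimately have "?z = 0\<^sub>v n" by blast
        then have "?z $ 1 = 0" using n by simp
        then show False using n by simp
      qed
      moreover have "\<eta> g *\<^sub>v z \<in> ?U" if "g \<in> carrier (VST n)" "z \<in> ?U" for g z
        using \<phi>[of g z] mat[of g] that by auto
      ultimately show False
        using irr subspace_of_lattice_kernel[of n "\<lambda>j. v ^ j"] unfolding irreducible_rep_def by blast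
    qed
  next
    assume rhs: "f \<noteq> v \<or> w + f\<^sup>2 * y * ?u \<noteq> 1 \<or> v * y + w \<noteq> 1"
    show "irreducible_rep (VST n) n \<eta>"
      unfolding irreducible_rep_def
    proof (rule notI, elim exE conjE)
      fix U assume U: "subspace_of_lattice n U" "U \<noteq> {0\<^sub>v n}" "U \<noteq> carrier_vec n"
        and inv: "\<forall>g\<in>carrier (VST n). \<forall>x\<in>U. \<eta> g *\<^sub>v x \<in> U"
      have gens: "\<eta> (vst_gen n l) *\<^sub>v x \<in> U" if "l \<in> vst_letters n" "x \<in> U" for l x
        using inv gen_carrier that by blast
      have mem: "S (Suc p) \<in> vst_letters n" "Tau (Suc p) \<in> vst_letters n" "Nu (Suc p) \<in> vst_letters n"
        if "Suc p < n" for p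
        using that by (auto simp: letters)
      note sums = column_or_row_sums_if_invariant[OF n U vu]
      have nu: "local_mat n (Suc p) (mat_of_rows_list 2 [[0, v], [?u, 0]]) *\<^sub>v x \<in> U"
        if "Suc p < n" "x \<in> U" for p x
        using gens[OF mem(3)[OF that(1)] that(2)] Nu[OF that(1)] by simp
      (* the zeros keep the shape of the block, so that the rule unifies *)
      have "0 + unit_inv f * v = 1 \<and> f * ?u + 0 = 1 \<or> 0 + f * ?u = 1 \<and> unit_inv f * v + 0 = 1"
        by (rule sums[OF nu]) (use gens mem S in metis)+
      then have "f * ?u = 1" by auto
      then have "f = v" using vu by (metis mult.assoc mult.commute mult_1)
      moreover have "w + y * v = 1 \<and> f\<^sup>2 * y * ?u + w = 1 \<or> w + f\<^sup>2 * y * ?u = 1 \<and> y * v + w = 1"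
        by (rule sums[OF nu]) (use gens mem Tau in metis)+
      ultimately show False using rhs by (auto simp: mult.commute add.commute)
    qed
  qed
qed

end
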